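(* Let $d$ be a positive integer, and let $e_i(x_1,\dots,x_d)$ denote the elementary symmetric function of degree $i$ in the indeterminates $x_1,\dots,x_d$. Then, as formal power series, $$ \sum_{m_1=0}^{\infty}\cdots\sum_{m_d=0}^{\infty} c(m_1,\dots,m_d)\,x_1^{m_1}\cdots x_d^{m_d} =\left(\prod_{i=1}^{d}x_i\right)\left(\prod_{i=1}^{d}(1-x_i)\right)^{-1}\left(1-\sum_{i=2}^{d}(i-1)\,e_i(x_1,\dots,x_d)\right)^{-1}. $$
   Context: For nonnegative integers $m_1,\dots,m_d$, the number $c(m_1,\dots,m_d)$ is defined as the coefficient of $\prod_{i=1}^{d} t_i^{m_i-1}$ in the polynomial $$ \prod_{i=1}^{d}\frac{\hat{t_i}^{\,m_i}-t_i^{m_i}}{\hat{t_i}-t_i},\qquad \hat{t_i}=\left(\sum_{j=1}^{d}t_j\right)-t_i , $$ where each factor is understood as the polynomial $\sum_{k=0}^{m_i-1}\hat{t_i}^{\,k}\,t_i^{\,m_i-1-k}$ (so it is $0$ if $m_i=0$, and hence $c(m_1,\dots,m_d)=0$ whenever some $m_i=0$). (By a theorem of Friedland and Ottaviani, for positive $m_i$ this is the number of simple singular vector tuples of a generic $m_1\times\cdots\times m_d$ tensor; the coefficient is taken as the definition here.) *)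

theory Defs
  imports "HOL-Library.Poly_Mapping"
begin

section \<open>Formal power series in the variables $x_0, x_1, x_2, \dots$\<close>

text \<open>
  A monomial is a finitely supported exponent vector of type \<^typ>\<open>nat \<Rightarrow>\<^sub>0 nat\<close>, and a
  power series is an arbitrary coefficient function on monomials.  The ring of power series in
  $x_1, \dots, x_d$ is the subring of those series whose coefficients vanish at every monomial
  involving a variable outside \<^term>\<open>{1..d}\<close>.
\<close>

typedef 'a mfps = "UNIV :: ((nat \<Rightarrow>\<^sub>0 nat) \<Rightarrow> 'a) set"
  morphisms mfps_nth Abs_mfps
  by simp

lemma mfps_nth_Abs [simp]: "mfps_nth (Abs_mfps f) m = f m"
  by (simp add: Abs_mfps_inverse)

lemma mfps_eqI: "(\<And>m. mfps_nth f m = mfps_nth g m) \<Longrightarrow> f = g"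
  by (metis ext mfps_nth_inject)

lemma finite_add_eq: "finite {(p, q). p + q = (m :: nat \<Rightarrow>\<^sub>0 nat)}"
proof -
  define F where "F = {f :: nat \<Rightarrow> nat. \<forall>i.
    (i \<in> Poly_Mapping.keys m \<longrightarrow> f i \<in> {..Max (Poly_Mapping.lookup m ` Poly_Mapping.keys m)}) \<and>
    (i \<notin> Poly_Mapping.keys m \<longrightarrow> f i = 0)}"
  define A where "A = Poly_Mapping.lookup -` F"
  have A: "p \<in> A" if le: "\<And>i. Poly_Mapping.lookup p i \<le> Poly_Mapping.lookup m i" for p
  proof -
    have "Poly_Mapping.lookup p i \<le> Max (Poly_Mapping.lookup m ` Poly_Mapping.keys m)"
      if "i \<in> Poly_Mapping.keys m" for i
      by (rule order_trans[OF le Max_ge]) (use that in auto)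
    moreover have "Poly_Mapping.lookup p i = 0" if "i \<notin> Poly_Mapping.keys m" for i
      using le[of i] that by (simp add: in_keys_iff)
    ultimately show ?thesis by (simp add: A_def F_def)
  qed
  have "finite F"
    unfolding F_def by (rule finite_set_of_finite_funs) auto
  then have "finite A"
    unfolding A_def by (rule finite_vimageI) (simp add: inj_def lookup_inject)
  then have "finite (A \<times> A)" by simp
  moreover have "{(p, q). p + q = m} \<subseteq> A \<times> A"
    by (auto intro!: A simp: lookup_add)
  ultimately show ?thesis by (rule finite_subset[rotated])
qed

instantiation mfps :: (comm_ring_1) comm_ring_1
begin

definition "0 = Abs_mfps (\<lambda>_. 0)"
definition "1 = Abs_mfps (\<lambda>m. if m = 0 then 1 else 0)"
definition "f + g = Abs_mfps (\<lambda>m. mfps_nth f m + mfps_nth g m)"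
definition "f - g = Abs_mfps (\<lambda>m. mfps_nth f m - mfps_nth g m)"
definition "- f = Abs_mfps (\<lambda>m. - mfps_nth f m)"
definition "f * g = Abs_mfps (\<lambda>m. \<Sum>(p, q) | p + q = m. mfps_nth f p * mfps_nth g q)"

instance
proof
  fix a b c :: "'a mfps"
  have *: "mfps_nth (a * b * c) m = mfps_nth (a * (b * c)) m" for m
  proof -
    let ?D = "\<lambda>m :: nat \<Rightarrow>\<^sub>0 nat. {(p, q). p + q = m}"
    have "mfps_nth (a * b * c) m =
        (\<Sum>u\<in>?D m. \<Sum>v\<in>?D (fst u). mfps_nth a (fst v) * mfps_nth b (snd v) * mfps_nth c (snd u))"
      by (simp add: times_mfps_def split_beta sum_distrib_right)
    also have "\<dots> = (\<Sum>(u, v)\<in>Sigma (?D m) (\<lambda>u. ?D (fst u)).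
        mfps_nth a (fst v) * mfps_nth b (snd v) * mfps_nth c (snd u))"
      by (rule sum.Sigma) (auto intro: finite_add_eq)
    also have "\<dots> = (\<Sum>(u, v)\<in>Sigma (?D m) (\<lambda>u. ?D (snd u)).
        mfps_nth a (fst u) * (mfps_nth b (fst v) * mfps_nth c (snd v)))"
      by (rule sum.reindex_bij_witness[where
            i = "\<lambda>(u, v). ((fst u + fst v, snd v), (fst u, fst v))" and
            j = "\<lambda>(u, v). ((fst v, snd v + snd u), (snd v, snd u))"])
         (auto simp: algebra_simps)
    also have "\<dots> = (\<Sum>u\<in>?D m. \<Sum>v\<in>?D (snd u).
        mfps_nth a (fst u) * (mfps_nth b (fst v) * mfps_nth c (snd v)))"
      by (rule sum.Sigma[symmetric]) (auto intro: finite_add_eq)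
    also have "\<dots> = mfps_nth (a * (b * c)) m"
      by (simp add: times_mfps_def split_beta sum_distrib_left)
    finally show ?thesis .
  qed
  show "a * b * c = a * (b * c)" by (rule mfps_eqI) (rule *)
  show "a * b = b * a"
  proof (rule mfps_eqI)
    fix m
    show "mfps_nth (a * b) m = mfps_nth (b * a) m"
      unfolding times_mfps_def mfps_nth_Abs
      by (rule sum.reindex_bij_witness[where i = prod.swap and j = prod.swap])
         (auto simp: algebra_simps)
  qed
  show "1 * a = a"
  proof (rule mfps_eqI)
    fix m
    have "mfps_nth (1 * a) m =
        (\<Sum>u\<in>{(p, q). p + q = m}. if u = (0, m) then mfps_nth a m else 0)"
      unfolding times_mfps_def mfps_nth_Abs
      by (rule sum.cong) (auto simp: one_mfps_def split: if_splits)
    also have "\<dots> = mfps_nth a m"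
      by (simp add: finite_add_eq)
    finally show "mfps_nth (1 * a) m = mfps_nth a m" .
  qed
  show "(a + b) * c = a * c + b * c"
    by (rule mfps_eqI)
       (simp add: times_mfps_def plus_mfps_def split_beta distrib_right sum.distrib)
  show "(0 :: 'a mfps) \<noteq> 1"
    proof
    assume "(0 :: 'a mfps) = 1"
    then have "mfps_nth (0 :: 'a mfps) 0 = mfps_nth 1 0" by (rule arg_cong)
    then show False by (simp add: zero_mfps_def one_mfps_def)
  qed
qed (auto intro!: mfps_eqI simp: zero_mfps_def plus_mfps_def minus_mfps_def uminus_mfps_def)

end

text \<open>
  As for other library types, \<^term>\<open>inverse f\<close> is \<^term>\<open>0\<close> when \<^term>\<open>f\<close> is not a unit.
\<close>

instantiation mfps :: (comm_ring_1) inverse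
begin

definition inverse_mfps_def: "inverse f = (if f dvd 1 then (THE g. f * g = 1) else (0 :: 'a mfps))"

definition divide_mfps_def: "f div g = f * inverse (g :: 'a mfps)"

instance ..

end

lemma mfps_mult_inverse:
  fixes f :: "'a :: comm_ring_1 mfps"
  assumes "f dvd 1"
  shows "f * inverse f = 1"
proof -
  from assms obtain g where g: "f * g = 1"
    by (metis dvdE)
  have "h = g" if "f * h = 1" for h
    by (metis g mult.assoc mult.commute mult_1_right that)
  with g have "(THE g. f * g = 1) = g" by (intro the_equality)
  with g assms show ?thesis by (simp add: inverse_mfps_def)
qed

definition total_degree :: "(nat \<Rightarrow>\<^sub>0 nat) \<Rightarrow> nat"
  where "total_degree m = (\<Sum>i\<in>Poly_Mapping.keys m. Poly_Mapping.lookup m i)"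

lemma total_degree_add: "total_degree (p + q) = total_degree p + total_degree q"
  unfolding total_degree_def
  by (rule setsum_keys_plus_distrib) simp_all

lemma total_degree_pos: "m \<noteq> 0 \<Longrightarrow> total_degree m > 0"
  by (auto simp: total_degree_def in_keys_iff sum_nonneg_eq_0_iff intro!: poly_mapping_eqI
      simp flip: neq0_conv)

lemma mfps_nth_power_eq_0:
  fixes h :: "'a :: comm_ring_1 mfps"
  assumes "mfps_nth h 0 = 0" and "total_degree m < k"
  shows "mfps_nth (h ^ k) m = 0"
  using assms(2)
proof (induction k arbitrary: m)
  case (Suc k)
  have "mfps_nth h p * mfps_nth (h ^ k) q = 0" if "p + q = m" for p q
  proof (cases "p = 0")
    case False
    with that Suc.prems total_degree_pos[OF False] have "total_degree q < k"
      by (auto simp: total_degree_add)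
    with Suc.IH show ?thesis by simp
  qed (simp add: assms(1))
  then show ?case
    by (auto simp: times_mfps_def intro!: sum.neutral)
qed simp

lemma mfps_nth_mult_cong:
  assumes "\<And>q. total_degree q \<le> total_degree m \<Longrightarrow> mfps_nth g q = mfps_nth h q"
  shows "mfps_nth (f * g) m = mfps_nth (f * h) m"
  unfolding times_mfps_def mfps_nth_Abs
  by (rule sum.cong) (auto simp: total_degree_add intro!: arg_cong2[of _ _ _ _ "(*)"] assms)

text \<open>
  Series with constant coefficient \<^term>\<open>1\<close> are units, by the geometric series; so
  \<^term>\<open>inverse f\<close> is their actual inverse.
\<close>

lemma mfps_is_unit:
  fixes f :: "'a :: comm_ring_1 mfps"
  assumes "mfps_nth f 0 = 1"
  shows "f dvd 1"
proof -
  let ?h = "1 - f"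
  have h0: "mfps_nth ?h 0 = 0"
    using assms by (simp add: minus_mfps_def one_mfps_def)
  have sum_nth: "mfps_nth (sum F A) m = (\<Sum>k\<in>A. mfps_nth (F k) m)"
    for F :: "nat \<Rightarrow> 'a mfps" and A m
    by (induction A rule: infinite_finite_induct) (auto simp: zero_mfps_def plus_mfps_def)
  define g where "g = Abs_mfps (\<lambda>m. \<Sum>k\<le>total_degree m. mfps_nth (?h ^ k) m)"
  have "mfps_nth (f * g) m = mfps_nth 1 m" for m
  proof -
    let ?N = "total_degree m"
    have "mfps_nth g q = mfps_nth (\<Sum>k\<le>?N. ?h ^ k) q" if "total_degree q \<le> ?N" for q
      unfolding g_def mfps_nth_Abs sum_nth
      by (rule sum.mono_neutral_left) (use that in \<open>auto intro!: mfps_nth_power_eq_0[OF h0]\<close>)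
    then have "mfps_nth (f * g) m = mfps_nth (f * (\<Sum>k\<le>?N. ?h ^ k)) m"
      by (rule mfps_nth_mult_cong)
    also have "f * (\<Sum>k\<le>?N. ?h ^ k) = 1 - ?h ^ Suc ?N"
      using sum_gp_basic[of ?h ?N] by simp
    also have "mfps_nth \<dots> m = mfps_nth 1 m"
      using mfps_nth_power_eq_0[OF h0, of m "Suc ?N"] by (simp add: minus_mfps_def)
    finally show ?thesis .
  qed
  then have "f * g = 1" by (rule mfps_eqI)
  then show ?thesis by (metis dvdI)
qed

definition mfps_X :: "nat \<Rightarrow> 'a :: comm_ring_1 mfps"
  where "mfps_X i = Abs_mfps (\<lambda>m. if m = Poly_Mapping.single i 1 then 1 else 0)"

text \<open>The series $\sum_m a(m) \prod_{i \in I} x_i^{m_i}$ over all exponent vectors $m$ on $I$:\<close>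

definition mfps_of_coeffs :: "nat set \<Rightarrow> ((nat \<Rightarrow> nat) \<Rightarrow> 'a) \<Rightarrow> 'a :: comm_ring_1 mfps"
  where "mfps_of_coeffs I a = Abs_mfps (\<lambda>m. if Poly_Mapping.keys m \<subseteq> I then a (Poly_Mapping.lookup m) else 0)"

definition elem_sym :: "nat \<Rightarrow> nat set \<Rightarrow> (nat \<Rightarrow> 'a) \<Rightarrow> 'a :: comm_ring_1"
  where "elem_sym k I x = (\<Sum>S | S \<subseteq> I \<and> card S = k. \<Prod>i\<in>S. x i)"


section \<open>The coefficients $c(m_1, \dots, m_d)$\<close>

text \<open>Integer polynomials in $t_0, t_1, \dots$ are finitely supported functions on monomials.\<close>

definition poly_t :: "nat \<Rightarrow> (nat \<Rightarrow>\<^sub>0 nat) \<Rightarrow>\<^sub>0 int"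
  where "poly_t i = Poly_Mapping.single (Poly_Mapping.single i 1) 1"

definition poly_t_hat :: "nat \<Rightarrow> nat \<Rightarrow> (nat \<Rightarrow>\<^sub>0 nat) \<Rightarrow>\<^sub>0 int"
  where "poly_t_hat d i = (\<Sum>j = 1..d. poly_t j) - poly_t i"

text \<open>
  If some $m_i$ with $1 \le i \le d$ is \<^term>\<open>0\<close>, the product below is \<^term>\<open>0\<close>, so
  the truncated subtraction in the exponent \<^term>\<open>m i - 1\<close> is harmless.
\<close>

definition sv_coeff :: "nat \<Rightarrow> (nat \<Rightarrow> nat) \<Rightarrow> int"
  where "sv_coeff d m =
    Poly_Mapping.lookup (\<Prod>i = 1..d. \<Sum>k<m i. poly_t_hat d i ^ k * poly_t i ^ (m i - 1 - k))
      (\<Sum>i = 1..d. Poly_Mapping.single i (m i - 1))"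

lemma sv_coeff_eq_0:
  assumes "i \<in> {1..d}" and "m i = 0"
  shows "sv_coeff d m = 0"
proof -
  have "(\<Sum>k<m i. poly_t_hat d i ^ k * poly_t i ^ (m i - 1 - k)) = 0"
    by (simp only: assms(2) lessThan_0 sum.empty)
  with assms(1) have "(\<Prod>i = 1..d. \<Sum>k<m i. poly_t_hat d i ^ k * poly_t i ^ (m i - 1 - k)) = 0"
    by (intro prod_zero) blast+
  then show ?thesis unfolding sv_coeff_def by (simp only: lookup_zero)
qed

end

theory Submission
  imports Defs
begin

text \<open>
  Write $S = t_1 + \dots + t_d$ and $h_i = S - t_i$, so that $h_i$ is $\hat t_i$.  After multiplication
  by $t_1 \cdots t_d$, the number $c(m)$ is the coefficient of $t^m$ in
  $\prod_i t_i q_i(m_i)$ with $q_i(n) = \sum_{k<n} h_i^k t_i^{n-1-k}$.  The proof works with all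
  ``diagonal'' series $\sum_m x^m [t^m] \prod_i \phi_i(m_i)$ at once, where each $\phi_i$ is an arbitrary
  sequence of polynomials.  Such a series is additive in each $\phi_i$, and a factor $t_i$ can be
  traded for a factor $x_i$ and an index shift: replacing $\phi_i(n)$ by $t_i \psi(n)$ gives $x_i$ times
  the series for $\psi(n+1)$ (\<open>diag_series_shift\<close>).  Recurrences for the $\phi_i$ thereby become
  algebraic relations between series.

  The recurrence $q_i(n+1) = t_i q_i(n) + h_i^n$ gives $\prod_i (1 - x_i) \sum_m c(m) x^m =
  \prod_i x_i \cdot F$ with $F = \sum_m x^m [t^m] \prod_i h_i^{m_i}$ (\<open>geometric_diag_series\<close>).

  It remains to evaluate $F$, which is MacMahon's master theorem for the matrix with zeros on the
  diagonal and ones elsewhere: $F$ is the inverse of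
  $D = \prod_i (1 + x_i) - \sum_i x_i \prod_{j \ne i} (1 + x_j)$.  From $h_i^n = (S - t_i) h_i^{n-1}$,
  multiplication by $1 + x_i$ turns the factor $h_i^{m_i}$ into $S h_i^{m_i-1}$ (if $m_i > 0$; into $1$
  otherwise), and multiplication by $x_i$ turns it into $t_i h_i^{m_i-1}$ (or $0$).  If
  $m \ne 0$ has support $s$, the coefficient of $x^m$ in $D F$ is therefore that of $t^m$ in
  \[ \Bigl(\prod_{i \in s} h_i^{m_i-1}\Bigr) S^{|s|-1} \Bigl(S - \sum_{i \in s} t_i\Bigr), \]
  and it vanishes because every term of the last factor is a variable that does not occur in $t^m$
  (\<open>master_theorem_coeff\<close>).  Expanding $D$ over subsets $T$ gives
  $\sum_T (1 - |T|) x^T = 1 - \sum_{i \ge 2} (i-1) e_i$.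
\<close>

abbreviation var_mon :: "nat \<Rightarrow> (nat \<Rightarrow>\<^sub>0 nat)"
  where "var_mon i \<equiv> Poly_Mapping.single i 1"

section \<open>Multiplication by a variable\<close>

lemma mon_split_var: "Poly_Mapping.lookup m i \<noteq> 0 \<Longrightarrow> m = var_mon i + (m - var_mon i)"
  by (rule poly_mapping_eqI) (auto simp: lookup_add lookup_minus lookup_single when_def)

lemma mfps_nth_X_mult:
  "mfps_nth (mfps_X i * f) m =
    (if Poly_Mapping.lookup m i = 0 then 0 else mfps_nth f (m - var_mon i))"
proof -
  have eq: "(\<lambda>(p, q). mfps_nth (mfps_X i :: 'a mfps) p * mfps_nth f q) =
      (\<lambda>u. if fst u = var_mon i then mfps_nth f (snd u) else 0)"
    by (auto simp: mfps_X_def fun_eq_iff)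
  have "mfps_nth (mfps_X i * f) m =
      (\<Sum>u\<in>{(p, q). p + q = m}. if fst u = var_mon i then mfps_nth f (snd u) else 0)"
    by (simp only: times_mfps_def mfps_nth_Abs eq)
  also have "\<dots> = (\<Sum>u\<in>{u. u \<in> {(p, q). p + q = m} \<and> fst u = var_mon i}. mfps_nth f (snd u))"
    by (rule sum.inter_filter[OF finite_add_eq, symmetric])
  also have "{u. u \<in> {(p, q). p + q = m} \<and> fst u = var_mon i} =
      (if Poly_Mapping.lookup m i = 0 then {} else {(var_mon i, m - var_mon i)})"
    using mon_split_var[of m i] by (auto simp: lookup_add)
  finally show ?thesis by simp
qed

lemma lookup_poly_t_mult:
  "Poly_Mapping.lookup (poly_t i * p) m =
    (if Poly_Mapping.lookup m i = 0 then 0 else Poly_Mapping.lookup p (m - var_mon i))"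
proof -
  have "Poly_Mapping.lookup (poly_t i) a * c = (c when a = var_mon i)" for a c
    by (auto simp: poly_t_def lookup_single when_def)
  then have "Poly_Mapping.lookup (poly_t i * p) m =
      (\<Sum>q. Poly_Mapping.lookup p q when m = var_mon i + q)"
    by (simp add: lookup_mult)
  also have "\<dots> = (if Poly_Mapping.lookup m i = 0 then 0 else Poly_Mapping.lookup p (m - var_mon i))"
  proof (cases "Poly_Mapping.lookup m i = 0")
    case True
    then have "m \<noteq> var_mon i + q" for q by (auto simp: lookup_add)
    with True show ?thesis by simp
  next
    case False
    then have "m = var_mon i + q \<longleftrightarrow> q = m - var_mon i" for q
      using mon_split_var[of m i] by auto
    with False show ?thesis by simp
  qed
  finally show ?thesis .
qed

section \<open>Diagonal series\<close>

text \<open>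
  This is $\sum_m x^m [t^m] \prod_{i \in I} \phi_i(m_i)$ over the monomials $m$ in the variables
  indexed by $I$: the exponent that picks the coefficient also picks the members of the
  sequences $\phi_i$.  Arbitrary sequences are admitted so that a single $\phi_i$ can be exchanged.
\<close>

definition diag_series ::
    "nat set \<Rightarrow> (nat \<Rightarrow> nat \<Rightarrow> ((nat \<Rightarrow>\<^sub>0 nat) \<Rightarrow>\<^sub>0 int)) \<Rightarrow> int mfps"
  where "diag_series I \<phi> = Abs_mfps (\<lambda>m.
    if Poly_Mapping.keys m \<subseteq> I
    then Poly_Mapping.lookup (\<Prod>i\<in>I. \<phi> i (Poly_Mapping.lookup m i)) m else 0)"

lemma prod_fun_upd:
  assumes "finite I" "i \<in> I"
  shows "(\<Prod>j\<in>I. (\<phi>(i := \<psi>)) j (e j)) = \<psi> (e i) * (\<Prod>j\<in>I - {i}. \<phi> j (e j))"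
  using assms by (simp add: prod.remove)

lemma diag_series_add:
  assumes "finite I" "i \<in> I"
  shows "diag_series I (\<phi>(i := \<lambda>n. a n + b n)) =
    diag_series I (\<phi>(i := a)) + diag_series I (\<phi>(i := b))"
  by (rule mfps_eqI)
     (simp add: diag_series_def plus_mfps_def prod_fun_upd[OF assms] distrib_right lookup_add
       del: fun_upd_apply)

text \<open>
  A multiple of $t_i$ contributes only to exponents with $m_i > 0$, where its coefficient at $t^m$
  is the cofactor's coefficient at $t^m / t_i$.  Thus $\psi(m_i)$ is paired with the exponent
  $m_i - 1$, which is the shift.
\<close>

lemma diag_series_shift:
  assumes "finite I" "i \<in> I"
  shows "diag_series I (\<phi>(i := \<lambda>n. poly_t i * \<psi> n)) =
    mfps_X i * diag_series I (\<phi>(i := \<lambda>n. \<psi> (Suc n)))"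
proof (rule mfps_eqI)
  fix m :: "nat \<Rightarrow>\<^sub>0 nat"
  let ?m' = "m - var_mon i"
  have "(Poly_Mapping.keys ?m' \<subseteq> I) = (Poly_Mapping.keys m \<subseteq> I)"
    using \<open>i \<in> I\<close> by (auto simp: in_keys_iff lookup_minus lookup_single when_def subset_eq split: if_splits)
  moreover have "(\<Prod>j\<in>I - {i}. \<phi> j (Poly_Mapping.lookup ?m' j)) =
      (\<Prod>j\<in>I - {i}. \<phi> j (Poly_Mapping.lookup m j))"
    by (rule prod.cong) (auto simp: lookup_minus lookup_single)
  ultimately show "mfps_nth (diag_series I (\<phi>(i := \<lambda>n. poly_t i * \<psi> n))) m =
      mfps_nth (mfps_X i * diag_series I (\<phi>(i := \<lambda>n. \<psi> (Suc n)))) m"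
    by (simp add: mfps_nth_X_mult diag_series_def prod_fun_upd[OF assms] lookup_poly_t_mult
        mult.assoc lookup_minus lookup_single del: fun_upd_apply)
qed

text \<open>
  Relations that exchange one sequence, valid whatever the other sequences are, can be
  applied to one index after the other.
\<close>

lemma diag_series_replace:
  assumes "finite I"
    and step: "\<And>i \<phi>. i \<in> I \<Longrightarrow>
      a i * diag_series I (\<phi>(i := \<alpha> i)) = b i * diag_series I (\<phi>(i := \<beta> i))"
  shows "(\<Prod>i\<in>I. a i) * diag_series I \<alpha> = (\<Prod>i\<in>I. b i) * diag_series I \<beta>"
proof -
  have "(\<Prod>i\<in>A. a i) * diag_series I \<alpha> =
      (\<Prod>i\<in>A. b i) * diag_series I (\<lambda>i. if i \<in> A then \<beta> i else \<alpha> i)" if "A \<subseteq> I" for A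
    using finite_subset[OF that \<open>finite I\<close>] that
  proof (induction A rule: finite_induct)
    case (insert i A)
    let ?\<phi> = "\<lambda>j. if j \<in> A then \<beta> j else \<alpha> j"
    have \<alpha>: "?\<phi>(i := \<alpha> i) = ?\<phi>" using insert.hyps by auto
    have \<beta>: "?\<phi>(i := \<beta> i) = (\<lambda>j. if j \<in> insert i A then \<beta> j else \<alpha> j)"
      by auto
    have "(\<Prod>j\<in>insert i A. a j) * diag_series I \<alpha> = (\<Prod>j\<in>A. b j) * (a i * diag_series I ?\<phi>)"
      using insert by (simp add: mult_ac)
    also have "a i * diag_series I ?\<phi> = b i * diag_series I (\<lambda>j. if j \<in> insert i A then \<beta> j else \<alpha> j)"
      using step[of i ?\<phi>] insert.prems by (simp only: \<alpha> \<beta>) simp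
    finally show ?case using insert.hyps by (simp add: mult_ac)
  qed simp
  from this[OF order_refl]
  have "(\<Prod>i\<in>I. a i) * diag_series I \<alpha> =
      (\<Prod>i\<in>I. b i) * diag_series I (\<lambda>i. if i \<in> I then \<beta> i else \<alpha> i)" .
  also have "diag_series I (\<lambda>i. if i \<in> I then \<beta> i else \<alpha> i) = diag_series I \<beta>"
  proof -
    have "(\<Prod>i\<in>I. (if i \<in> I then \<beta> i else \<alpha> i) (e i)) = (\<Prod>i\<in>I. \<beta> i (e i))" for e
      by (rule prod.cong) auto
    then show ?thesis by (simp only: diag_series_def)
  qed
  finally show ?thesis .
qed

section \<open>From truncated geometric sums to powers\<close>

text \<open>
  With $q(n) = \sum_{k<n} h^k t^{n-1-k}$ the recurrence $q(n+1) = t q(n) + h^n$ becomes, after the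
  shift, an equation in which the series for $t q(n)$ occurs on both sides; solving it yields the
  factor $1 - x_i$.
\<close>

lemma geometric_diag_series:
  fixes h :: "nat \<Rightarrow> ((nat \<Rightarrow>\<^sub>0 nat) \<Rightarrow>\<^sub>0 int)"
  assumes "finite I"
  shows "(\<Prod>i\<in>I. 1 - mfps_X i) *
      diag_series I (\<lambda>i n. poly_t i * (\<Sum>k<n. h i ^ k * poly_t i ^ (n - 1 - k))) =
    (\<Prod>i\<in>I. mfps_X i) * diag_series I (\<lambda>i n. h i ^ n)"
proof (rule diag_series_replace[OF assms])
  fix i \<phi>
  assume "i \<in> I"
  define q where "q n = (\<Sum>k<n. h i ^ k * poly_t i ^ (n - 1 - k))" for n
  have q_Suc: "q (Suc n) = poly_t i * q n + h i ^ n" for n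
  proof -
    have "(\<Sum>k<n. h i ^ k * poly_t i ^ (n - k)) = (\<Sum>k<n. poly_t i * (h i ^ k * poly_t i ^ (n - 1 - k)))"
    proof (rule sum.cong)
      fix k assume "k \<in> {..<n}"
      then have "n - k = Suc (n - 1 - k)" by auto
      then show "h i ^ k * poly_t i ^ (n - k) = poly_t i * (h i ^ k * poly_t i ^ (n - 1 - k))"
        by (simp only: power_Suc mult_ac)
    qed simp
    then show ?thesis by (simp add: q_def sum_distrib_left)
  qed
  have "diag_series I (\<phi>(i := \<lambda>n. poly_t i * q n)) =
      mfps_X i * (diag_series I (\<phi>(i := \<lambda>n. poly_t i * q n)) +
        diag_series I (\<phi>(i := \<lambda>n. h i ^ n)))"
    by (subst diag_series_shift[OF assms \<open>i \<in> I\<close>])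
       (simp only: q_Suc diag_series_add[OF assms \<open>i \<in> I\<close>])
  then show "(1 - mfps_X i) * diag_series I
        (\<phi>(i := \<lambda>n. poly_t i * (\<Sum>k<n. h i ^ k * poly_t i ^ (n - 1 - k)))) =
      mfps_X i * diag_series I (\<phi>(i := \<lambda>n. h i ^ n))"
    unfolding q_def by (simp add: algebra_simps)
qed

section \<open>The master theorem\<close>

lemma lookup_prod_var_outside:
  assumes "Poly_Mapping.lookup m i = 0"
  shows "Poly_Mapping.lookup (p * poly_t i) m = 0"
  using assms by (simp add: lookup_poly_t_mult mult.commute[of p])

text \<open>
  The sequences $w$ and $v$ are what multiplication by $1 + x_i$ and by $x_i$ makes of the
  sequence of powers of $h_i$.  On the support of $m$ the products are a common factor
  $R$ times $S$, respectively $t_i$, and $S$ minus the sum of the supported $t_i$ consists of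
  variables foreign to $t^m$.
\<close>

lemma master_theorem_coeff:
  fixes h :: "nat \<Rightarrow> ((nat \<Rightarrow>\<^sub>0 nat) \<Rightarrow>\<^sub>0 int)"
  assumes "finite I"
  defines "S \<equiv> \<Sum>j\<in>I. poly_t j"
  defines "w \<equiv> \<lambda>(i::nat) n. if n = 0 then 1 else S * h i ^ (n - 1)"
  defines "v \<equiv> \<lambda>(i::nat) n. if n = 0 then 0 else h i ^ (n - 1)"
  shows "diag_series I w - (\<Sum>i\<in>I. diag_series I (w(i := \<lambda>n. poly_t i * v i n))) = 1"
proof (rule mfps_eqI)
  fix m :: "nat \<Rightarrow>\<^sub>0 nat"
  let ?e = "Poly_Mapping.lookup m" and ?s = "Poly_Mapping.keys m"
  let ?W = "\<Prod>j\<in>I. w j (?e j)"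
  let ?V = "\<lambda>i. poly_t i * v i (?e i) * (\<Prod>j\<in>I - {i}. w j (?e j))"
  have sum_nth: "mfps_nth (sum F A) m = (\<Sum>k\<in>A. mfps_nth (F k) m)"
    for F :: "nat \<Rightarrow> int mfps" and A
    by (induction A rule: infinite_finite_induct) (auto simp: zero_mfps_def plus_mfps_def)
  have "mfps_nth (diag_series I w - (\<Sum>i\<in>I. diag_series I (w(i := \<lambda>n. poly_t i * v i n)))) m =
      (if ?s \<subseteq> I then Poly_Mapping.lookup (?W - (\<Sum>i\<in>I. ?V i)) m else 0)"
    using assms(1)
    by (simp add: minus_mfps_def sum_nth diag_series_def prod_fun_upd lookup_minus lookup_sum
        del: fun_upd_apply)
  also have "\<dots> = (if m = 0 then 1 else 0)"
  proof (cases "m = 0")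
    case True
    then show ?thesis by (simp add: w_def v_def)
  next
    case False
    have "Poly_Mapping.lookup (?W - (\<Sum>i\<in>I. ?V i)) m = 0" if "?s \<subseteq> I"
    proof -
      define R where "R = S ^ (card ?s - 1) * (\<Prod>j\<in>?s. h j ^ (?e j - 1))"
      \<comment> \<open>Used for empty \<open>B\<close>, and for singletons \<open>B\<close> inside the support, where one factor $S$ is lost.\<close>
      have w_prod: "(\<Prod>j\<in>I - B. w j (?e j)) =
          S ^ card (?s - B) * (\<Prod>j\<in>?s - B. h j ^ (?e j - 1))" for B
      proof -
        have "(\<Prod>j\<in>I - B. w j (?e j)) = (\<Prod>j\<in>?s - B. w j (?e j))"
          using that assms(1) by (intro prod.mono_neutral_right) (auto simp: w_def in_keys_iff)
        also have "\<dots> = (\<Prod>j\<in>?s - B. S * h j ^ (?e j - 1))"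
          by (rule prod.cong) (auto simp: w_def in_keys_iff)
        finally show ?thesis by (simp add: prod.distrib)
      qed
      have "card ?s > 0" using False by (simp add: card_gt_0_iff)
      then have "S ^ card ?s = S * S ^ (card ?s - 1)" by (cases "card ?s") auto
      then have W: "?W = R * S"
        using w_prod[of "{}"] by (simp add: R_def mult_ac)
      have V: "?V i = R * poly_t i" if "i \<in> ?s" for i
        using w_prod[of "{i}"] that
        by (simp add: R_def v_def in_keys_iff mult_ac prod.remove[of ?s i])
      have "(\<Sum>i\<in>I. ?V i) = (\<Sum>i\<in>?s. R * poly_t i)"
        using that assms(1)
        by (intro sum.mono_neutral_cong_right) (simp_all add: V, simp_all add: v_def in_keys_iff)
      moreover have "R * S = (\<Sum>i\<in>?s. R * poly_t i) + (\<Sum>i\<in>I - ?s. R * poly_t i)"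
        unfolding S_def sum_distrib_left using that assms(1) by (simp add: sum.subset_diff)
      ultimately have "?W - (\<Sum>i\<in>I. ?V i) = (\<Sum>i\<in>I - ?s. R * poly_t i)"
        by (simp add: W)
      also have "Poly_Mapping.lookup \<dots> m = 0"
        unfolding lookup_sum
        by (intro sum.neutral ballI lookup_prod_var_outside) (simp add: in_keys_iff)
      finally show ?thesis .
    qed
    with False show ?thesis by simp
  qed
  also have "\<dots> = mfps_nth 1 m" by (simp add: one_mfps_def)
  finally show "mfps_nth (diag_series I w -
    (\<Sum>i\<in>I. diag_series I (w(i := \<lambda>n. poly_t i * v i n)))) m = mfps_nth 1 m" .
qed

text \<open>
  The splitting $w(n) = h_i^n + t_i v(n)$ expresses $S h_i^{n-1} = h_i^n + t_i h_i^{n-1}$, with the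
  values $w(0) = 1$ and $v(0) = 0$ chosen to make it hold at $n = 0$ too.  The shift rule then
  identifies $x_i$ times the series for $h_i^n$ with the series for $t_i v(n)$, and hence $1 + x_i$ times
  it with the series for $w$.
\<close>

lemma master_theorem:
  assumes "finite I"
  shows "((\<Prod>i\<in>I. 1 + mfps_X i) - (\<Sum>i\<in>I. mfps_X i * (\<Prod>j\<in>I - {i}. 1 + mfps_X j))) *
    diag_series I (\<lambda>i n. ((\<Sum>j\<in>I. poly_t j) - poly_t i) ^ n) = 1"
proof -
  define S where "S = (\<Sum>j\<in>I. poly_t j)"
  define h where "h i = S - poly_t i" for i
  define w where "w = (\<lambda>(i::nat) n. if n = 0 then 1 else S * h i ^ (n - 1))"
  define v where "v = (\<lambda>(i::nat) n. if n = 0 then 0 else h i ^ (n - 1))"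
  let ?F = "diag_series I (\<lambda>i n. h i ^ n)"
  have v_step: "mfps_X i * diag_series I (\<phi>(i := \<lambda>n. h i ^ n)) =
      diag_series I (\<phi>(i := \<lambda>n. poly_t i * v i n))" if "i \<in> I" for i \<phi>
    by (subst diag_series_shift[OF assms that]) (simp add: v_def)
  have w_eq: "w i = (\<lambda>n. h i ^ n + poly_t i * v i n)" for i
    by (auto simp: w_def v_def fun_eq_iff h_def power_eq_if algebra_simps)
  have w_step: "(1 + mfps_X i) * diag_series I (\<phi>(i := \<lambda>n. h i ^ n)) =
      diag_series I (\<phi>(i := w i))" if "i \<in> I" for i \<phi>
    by (simp only: w_eq diag_series_add[OF assms that] flip: v_step[OF that])
       (simp add: algebra_simps)
  have W: "(\<Prod>i\<in>I. 1 + mfps_X i) * ?F = diag_series I w"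
    using diag_series_replace[OF assms, of "\<lambda>i. 1 + mfps_X i" "\<lambda>i n. h i ^ n" "\<lambda>_. 1" w]
    by (simp add: w_step del: fun_upd_apply)
  have V: "mfps_X i * (\<Prod>j\<in>I - {i}. 1 + mfps_X j) * ?F =
      diag_series I (w(i := \<lambda>n. poly_t i * v i n))" if "i \<in> I" for i
  proof -
    let ?a = "\<lambda>j. if j = i then mfps_X i else 1 + mfps_X j :: int mfps"
    have "(\<Prod>j\<in>I. ?a j) * ?F =
        (\<Prod>j\<in>I. 1) * diag_series I (w(i := \<lambda>n. poly_t i * v i n))"
      by (rule diag_series_replace[OF assms]) (auto simp: v_step w_step fun_upd_same fun_upd_other simp del: fun_upd_apply)
    moreover have "(\<Prod>j\<in>I. ?a j) = mfps_X i * (\<Prod>j\<in>I - {i}. 1 + mfps_X j)"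
      using assms that by (simp add: prod.remove)
    ultimately show ?thesis by (simp only: prod.neutral_const mult_1_left)
  qed
  have "((\<Prod>i\<in>I. 1 + mfps_X i) - (\<Sum>i\<in>I. mfps_X i * (\<Prod>j\<in>I - {i}. 1 + mfps_X j))) * ?F =
      diag_series I w - (\<Sum>i\<in>I. diag_series I (w(i := \<lambda>n. poly_t i * v i n)))"
    by (simp add: left_diff_distrib sum_distrib_right W V)
  also have "\<dots> = 1"
    unfolding w_def v_def S_def by (rule master_theorem_coeff[OF assms])
  finally show ?thesis by (simp add: h_def S_def)
qed

section \<open>The denominator in elementary symmetric functions\<close>

text \<open>
  A subset $T$ arises once from the first product, and once from the summand of each $i \in T$
  in the second, so its monomial has the coefficient $1 - |T|$.
\<close>

lemma prod_one_plus_minus_sum_eq: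
  fixes x :: "'b \<Rightarrow> 'a :: comm_ring_1"
  assumes "finite I"
  shows "(\<Prod>i\<in>I. 1 + x i) - (\<Sum>i\<in>I. x i * (\<Prod>j\<in>I - {i}. 1 + x j)) =
    (\<Sum>T\<in>Pow I. (1 - of_nat (card T)) * (\<Prod>i\<in>T. x i))"
  using assms
proof (induction I rule: finite_induct)
  case (insert a I)
  let ?P = "\<Prod>i\<in>I. 1 + x i" and ?Q = "\<Sum>i\<in>I. x i * (\<Prod>j\<in>I - {i}. 1 + x j)"
  have P: "?P = (\<Sum>T\<in>Pow I. \<Prod>i\<in>T. x i)"
    using prod_add[OF insert.hyps(1), of x "\<lambda>_. 1"] by (simp add: add.commute)
  have "x i * (\<Prod>j\<in>insert a I - {i}. 1 + x j) = (1 + x a) * (x i * (\<Prod>j\<in>I - {i}. 1 + x j))"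
    if "i \<in> I" for i
  proof -
    have "insert a I - {i} = insert a (I - {i})" using that insert.hyps by auto
    then show ?thesis using insert.hyps by (simp add: mult_ac)
  qed
  then have Q: "(\<Sum>i\<in>insert a I. x i * (\<Prod>j\<in>insert a I - {i}. 1 + x j)) = x a * ?P + (1 + x a) * ?Q"
    using insert.hyps by (simp add: sum_distrib_left)
  have inj: "inj_on (insert a) (Pow I)" and disj: "Pow I \<inter> insert a ` Pow I = {}"
    using insert.hyps by (auto simp: inj_on_def)
  have "(\<Sum>T\<in>Pow (insert a I). (1 - of_nat (card T)) * (\<Prod>i\<in>T. x i)) =
      (\<Sum>T\<in>Pow I. (1 - of_nat (card T)) * (\<Prod>i\<in>T. x i)) +
      (\<Sum>T\<in>Pow I. (1 - of_nat (card (insert a T))) * (\<Prod>i\<in>insert a T. x i))"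
    using insert.hyps by (simp add: Pow_insert sum.union_disjoint[OF _ _ disj] sum.reindex[OF inj])
  also have "(\<Sum>T\<in>Pow I. (1 - of_nat (card (insert a T))) * (\<Prod>i\<in>insert a T. x i)) =
      (\<Sum>T\<in>Pow I. x a * ((1 - of_nat (card T)) * (\<Prod>i\<in>T. x i)) - x a * (\<Prod>i\<in>T. x i))"
  proof (rule sum.cong)
    fix T assume "T \<in> Pow I"
    with insert.hyps have "finite T" "a \<notin> T" by (auto intro: finite_subset)
    then show "(1 - of_nat (card (insert a T))) * (\<Prod>i\<in>insert a T. x i) =
        x a * ((1 - of_nat (card T)) * (\<Prod>i\<in>T. x i)) - x a * (\<Prod>i\<in>T. x i)"
      by (simp add: algebra_simps)
  qed simp
  also have "\<dots> = x a * (?P - ?Q) - x a * ?P"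
    by (simp only: sum_subtractf insert.IH[symmetric] P[symmetric] sum_distrib_left[symmetric])
  also have "(\<Sum>T\<in>Pow I. (1 - of_nat (card T)) * (\<Prod>i\<in>T. x i)) = ?P - ?Q"
    by (rule insert.IH[symmetric])
  finally show ?case
    using insert.hyps unfolding Q by (simp add: algebra_simps)
qed simp

text \<open>
  Sorting the subsets by cardinality produces the elementary symmetric functions; $e_1$ drops out
  because its coefficient is $1 - 1$.
\<close>

lemma denominator_eq_elem_sym:
  fixes x :: "nat \<Rightarrow> 'a :: comm_ring_1"
  assumes "d > 0"
  shows "(\<Prod>i=1..d. 1 + x i) - (\<Sum>i=1..d. x i * (\<Prod>j\<in>{1..d} - {i}. 1 + x j)) =
    1 - (\<Sum>i = 2..d. of_nat (i - 1) * elem_sym i {1..d} x)"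
proof -
  have card_le: "card ` Pow {1..d} \<subseteq> {0..d}"
    using card_mono[of "{1..d}"] by fastforce
  have "(\<Prod>i=1..d. 1 + x i) - (\<Sum>i=1..d. x i * (\<Prod>j\<in>{1..d} - {i}. 1 + x j)) =
      (\<Sum>T\<in>Pow {1..d}. (1 - of_nat (card T)) * (\<Prod>i\<in>T. x i))"
    by (rule prod_one_plus_minus_sum_eq) simp
  also have "\<dots> = (\<Sum>k=0..d. \<Sum>T | T \<in> Pow {1..d} \<and> card T = k. (1 - of_nat (card T)) * (\<Prod>i\<in>T. x i))"
    by (rule sum.group[symmetric]) (use card_le in auto)
  also have "\<dots> = (\<Sum>k=0..d. (1 - of_nat k) * elem_sym k {1..d} x)"
    by (simp add: elem_sym_def sum_distrib_left)
  also have "\<dots> = elem_sym 0 {1..d} x + (\<Sum>k=2..d. (1 - of_nat k) * elem_sym k {1..d} x)"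
    using assms by (simp add: sum.atLeast_Suc_atMost numeral_2_eq_2)
  also have "elem_sym 0 {1..d} x = 1"
  proof -
    have "{T. T \<subseteq> {1..d} \<and> card T = 0} = {{}}"
      by (auto dest: finite_subset)
    then show ?thesis by (simp add: elem_sym_def)
  qed
  also have "(\<Sum>k=2..d. (1 - of_nat k) * elem_sym k {1..d} x) =
      - (\<Sum>k=2..d. of_nat (k - 1) * elem_sym k {1..d} x)"
    by (simp add: of_nat_diff algebra_simps flip: sum_negf)
  finally show ?thesis by simp
qed

section \<open>The generating function\<close>

lemma lookup_sum_single:
  fixes e :: "nat \<Rightarrow> nat"
  assumes "finite I"
  shows "Poly_Mapping.lookup (\<Sum>i\<in>I. Poly_Mapping.single i (e i)) j = (if j \<in> I then e j else 0)"
  using assms by (simp add: lookup_sum lookup_single when_def)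

lemma lookup_prod_poly_t_mult:
  assumes "finite A" and "\<And>i. i \<in> A \<Longrightarrow> Poly_Mapping.lookup m i \<noteq> 0"
  shows "Poly_Mapping.lookup ((\<Prod>i\<in>A. poly_t i) * p) m =
    Poly_Mapping.lookup p (m - (\<Sum>i\<in>A. var_mon i))"
  using assms
proof (induction A arbitrary: m rule: finite_induct)
  case (insert i A)
  have "Poly_Mapping.lookup (m - var_mon i) j \<noteq> 0" if "j \<in> A" for j
    using that insert.prems[of j] insert.hyps by (auto simp: lookup_minus lookup_single when_def)
  moreover have "Poly_Mapping.lookup m i \<noteq> 0" using insert.prems by blast
  ultimately show ?case
    using insert.IH[of "m - var_mon i"] insert.hyps
    by (simp add: lookup_poly_t_mult mult.assoc diff_diff_add)
qed simp

text \<open>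
  The definition reads off the coefficient at $t^{m-1}$, with all exponents lowered by one;
  the factors $t_i$ raise it to $t^m$, as a diagonal series requires.  If some $m_i$ is zero, both sides
  vanish because the corresponding geometric sum is empty.
\<close>

lemma sv_coeff_series_eq_diag:
  "mfps_of_coeffs {1..d} (sv_coeff d) =
    diag_series {1..d} (\<lambda>i n. poly_t i * (\<Sum>k<n. poly_t_hat d i ^ k * poly_t i ^ (n - 1 - k)))"
proof (rule mfps_eqI)
  fix m :: "nat \<Rightarrow>\<^sub>0 nat"
  let ?e = "Poly_Mapping.lookup m"
  let ?Q = "\<Prod>i=1..d. \<Sum>k<?e i. poly_t_hat d i ^ k * poly_t i ^ (?e i - 1 - k)"
  have "sv_coeff d ?e = Poly_Mapping.lookup ((\<Prod>i=1..d. poly_t i) * ?Q) m"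
    if keys: "Poly_Mapping.keys m \<subseteq> {1..d}"
  proof (cases "\<exists>i\<in>{1..d}. ?e i = 0")
    case True
    then obtain i where i: "i \<in> {1..d}" "?e i = 0" by blast
    then have "?Q = 0" by (intro prod_zero) (auto intro!: bexI[of _ i])
    with sv_coeff_eq_0[of i d ?e, OF i] show ?thesis
      by (simp only: mult_zero_right lookup_zero)
  next
    case False
    have "(\<Sum>i=1..d. Poly_Mapping.single i (?e i - 1)) = m - (\<Sum>i=1..d. var_mon i)"
      by (rule poly_mapping_eqI)
         (use keys in \<open>auto simp: lookup_sum_single lookup_minus in_keys_iff\<close>)
    with False show ?thesis
      unfolding sv_coeff_def by (subst lookup_prod_poly_t_mult) auto
  qed
  then show "mfps_nth (mfps_of_coeffs {1..d} (sv_coeff d)) m = mfps_nth (diag_series {1..d}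
      (\<lambda>i n. poly_t i * (\<Sum>k<n. poly_t_hat d i ^ k * poly_t i ^ (n - 1 - k)))) m"
    by (simp add: mfps_of_coeffs_def diag_series_def prod.distrib)
qed

lemma mfps_inverse_unique:
  fixes f g :: "'a :: comm_ring_1 mfps"
  assumes "f * g = 1"
  shows "inverse f = g"
proof -
  have "f dvd 1" using assms dvd_triv_left[of f g] by simp
  then have "f * inverse f = 1" by (rule mfps_mult_inverse)
  then have "g * (f * inverse f) = g" by simp
  then show ?thesis using assms by (simp add: mult.commute flip: mult.assoc)
qed

lemma prod_one_minus_X_unit:
  "(\<Prod>i\<in>A. 1 - mfps_X i) dvd (1 :: 'a :: comm_ring_1 mfps)"
proof (induction A rule: infinite_finite_induct)
  case (insert i A)
  have "0 \<noteq> var_mon i" by (metis lookup_single_eq lookup_zero zero_neq_one)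
  then have "(1 - mfps_X i) dvd (1 :: 'a mfps)"
    by (intro mfps_is_unit) (simp add: minus_mfps_def one_mfps_def mfps_X_def)
  from mult_dvd_mono[OF this insert.IH] insert.hyps show ?case by simp
qed simp_all

theorem proposition1:
  fixes d :: nat
  assumes "d > 0"
  shows "mfps_of_coeffs {1..d} (sv_coeff d) =
    (\<Prod>i = 1..d. mfps_X i) *
    inverse (\<Prod>i = 1..d. 1 - mfps_X i) *
    inverse (1 - (\<Sum>i = 2..d. of_nat (i - 1) * elem_sym i {1..d} mfps_X))"
proof -
  let ?C = "mfps_of_coeffs {1..d} (sv_coeff d)"
  let ?F = "diag_series {1..d} (\<lambda>i n. poly_t_hat d i ^ n)"
  let ?X = "\<Prod>i = 1..d. mfps_X i :: int mfps"
  let ?E = "\<Prod>i = 1..d. 1 - mfps_X i :: int mfps"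
  let ?D = "1 - (\<Sum>i = 2..d. of_nat (i - 1) * elem_sym i {1..d} mfps_X) :: int mfps"
  have E: "?E * inverse ?E = 1" by (rule mfps_mult_inverse) (rule prod_one_minus_X_unit)
  have F: "?D * ?F = 1"
    using master_theorem[of "{1..d}"] denominator_eq_elem_sym[OF assms, of "mfps_X :: nat \<Rightarrow> int mfps"]
    by (simp add: poly_t_hat_def)
  have "?E * ?C = ?X * ?F"
    unfolding sv_coeff_series_eq_diag by (rule geometric_diag_series) simp
  then have "inverse ?E * (?E * ?C) = inverse ?E * (?X * ?F)" by (rule arg_cong)
  moreover have "inverse ?E * (?E * ?C) = ?E * inverse ?E * ?C" by (simp only: mult_ac)
  ultimately have "?C = inverse ?E * (?X * ?F)" by (simp only: E mult_1_left)
  then show ?thesis unfolding mfps_inverse_unique[OF F] by (simp only: mult_ac)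
qed

end
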